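(* Let $S$ be a finitely aligned $k$-monoid each of whose alphabets is finite and has cardinality at least $2$. Then $\mathsf{P}(S)^{e}/\sigma\cong\mathsf{R}(S)^{e}/\sigma$.
   Context: A $k$-monoid ($k\ge1$) is a countable monoid $S$ with a monoid homomorphism $d\colon S\to\mathbb{N}^k$ such that whenever $d(x)=\mathbf{m}+\mathbf{n}$ there are unique $x_1,x_2\in S$ with $x=x_1x_2$, $d(x_1)=\mathbf{m}$, $d(x_2)=\mathbf{n}$. Its alphabets are $X_i=d^{-1}(\mathbf{e}_i)$, $1\le i\le k$, where $\mathbf{e}_i$ is the $i$-th standard unit vector. $S$ is finitely aligned if for all $a,b\in S$ the right ideal $aS\cap bS$ is empty or finitely generated. Elements $x,y$ are comparable if $xS\cap yS\ne\varnothing$, otherwise incomparable; a generalized prefix code is a finite non-empty subset of $S$ whose distinct elements are pairwise incomparable. $\mathsf{R}(S)$ is the inverse monoid, under composition of partial functions, of all bijective morphisms $\alpha\colon XS\to YS$ between finitely generated right ideals of $S$ ($X,Y$ finite, the empty ideal and empty function included), where a morphism satisfies $\alpha(as)=\alpha(a)s$ for all $a\in XS$, $s\in S$. A finitely generated right ideal is projective if it has the form $XS$ with $X$ a generalized prefix code. $\mathsf{P}(S)$ is the inverse submonoid of $\mathsf{R}(S)$ of all bijective morphisms between finitely generated projective right ideals (together with the empty function). In an inverse semigroup $T$ with zero, a non-zero idempotent $e$ is essential if $ef\neq 0$ for every non-zero idempotent $f$; $T^e$ is the inverse subsemigroup of all $s\in T$ with $s^{-1}s$ and $ss^{-1}$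 essential. $\sigma$ denotes the minimum group congruence on an inverse semigroup: $s\,\sigma\,t$ iff there is $u\le s,t$ in the natural partial order. *)

theory Defs
  imports
    "HOL-Analysis.Finite_Cartesian_Product"
    "HOL-Library.Countable_Set"
    "HOL-Algebra.Coset"
begin

text \<open>
  The index \<open>k\<close> is the cardinality of the finite type \<^typ>\<open>'k\<close>, which is at least 1 since types are
  non-empty; \<^typ>\<open>nat ^ 'k\<close> is the additive monoid of \<open>k\<close>-tuples of natural numbers.
\<close>

locale k_monoid = monoid S
  for S :: "('a, 'b) monoid_scheme" (structure) +
  fixes d :: "'a \<Rightarrow> nat ^ 'k"
  assumes countable_carrier: "countable (carrier S)"
    and degree_one: "d \<one> = 0"
    and degree_mult: "\<lbrakk>x \<in> carrier S; y \<in> carrier S\<rbrakk> \<Longrightarrow> d (x \<otimes> y) = d x + d y"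
    and unique_factorization:
      "\<lbrakk>x \<in> carrier S; d x = m + n\<rbrakk> \<Longrightarrow>
        \<exists>!(x1, x2). x1 \<in> carrier S \<and> x2 \<in> carrier S \<and> x = x1 \<otimes> x2 \<and> d x1 = m \<and> d x2 = n"

definition alphabet :: "('a, 'b) monoid_scheme \<Rightarrow> ('a \<Rightarrow> nat ^ 'k) \<Rightarrow> 'k \<Rightarrow> 'a set" where
  "alphabet S d i = {x \<in> carrier S. d x = axis i 1}"

text \<open>The generating set may be empty, so the empty right ideal is finitely generated.\<close>

definition fg_right_ideal :: "('a, 'b) monoid_scheme \<Rightarrow> 'a set \<Rightarrow> bool" where
  "fg_right_ideal S I \<longleftrightarrow> (\<exists>X. finite X \<and> X \<subseteq> carrier S \<and> I = X <#>\<^bsub>S\<^esub> carrier S)"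

definition finitely_aligned :: "('a, 'b) monoid_scheme \<Rightarrow> bool" where
  "finitely_aligned S \<longleftrightarrow>
    (\<forall>a\<in>carrier S. \<forall>b\<in>carrier S.
      let I = (a <#\<^bsub>S\<^esub> carrier S) \<inter> (b <#\<^bsub>S\<^esub> carrier S) in I = {} \<or> fg_right_ideal S I)"

definition comparable :: "('a, 'b) monoid_scheme \<Rightarrow> 'a \<Rightarrow> 'a \<Rightarrow> bool" where
  "comparable S x y \<longleftrightarrow> (x <#\<^bsub>S\<^esub> carrier S) \<inter> (y <#\<^bsub>S\<^esub> carrier S) \<noteq> {}"

definition generalized_prefix_code :: "('a, 'b) monoid_scheme \<Rightarrow> 'a set \<Rightarrow> bool" where
  "generalized_prefix_code S X \<longleftrightarrow>
    finite X \<and> X \<noteq> {} \<and> X \<subseteq> carrier S \<and> (\<forall>x\<in>X. \<forall>y\<in>X. x \<noteq> y \<longrightarrow> \<not> comparable S x y)"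

definition projective_right_ideal :: "('a, 'b) monoid_scheme \<Rightarrow> 'a set \<Rightarrow> bool" where
  "projective_right_ideal S I \<longleftrightarrow>
    (\<exists>X. generalized_prefix_code S X \<and> I = X <#>\<^bsub>S\<^esub> carrier S)"

definition bijective_morphism ::
    "('a, 'b) monoid_scheme \<Rightarrow> 'a set \<Rightarrow> 'a set \<Rightarrow> ('a \<rightharpoonup> 'a) \<Rightarrow> bool" where
  "bijective_morphism S I J \<alpha> \<longleftrightarrow>
    dom \<alpha> = I \<and> ran \<alpha> = J \<and> inj_on \<alpha> I \<and>
    (\<forall>a\<in>I. \<forall>s\<in>carrier S. \<alpha> (a \<otimes>\<^bsub>S\<^esub> s) = Some (the (\<alpha> a) \<otimes>\<^bsub>S\<^esub> s))"

text \<open>Products are composed from right to left: \<open>(\<alpha> \<circ>\<^sub>m \<beta>) a = \<alpha> (\<beta> a)\<close> wherever this makes sense.\<close>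

definition R_monoid :: "('a, 'b) monoid_scheme \<Rightarrow> ('a \<rightharpoonup> 'a) monoid" where
  "R_monoid S =
    \<lparr>carrier = {\<alpha>. \<exists>I J. fg_right_ideal S I \<and> fg_right_ideal S J \<and> bijective_morphism S I J \<alpha>},
     mult = (\<circ>\<^sub>m),
     one = Some |` carrier S\<rparr>"

definition P_monoid :: "('a, 'b) monoid_scheme \<Rightarrow> ('a \<rightharpoonup> 'a) monoid" where
  "P_monoid S = (R_monoid S)
    \<lparr>carrier := insert Map.empty
      {\<alpha>. \<exists>I J. projective_right_ideal S I \<and> projective_right_ideal S J \<and>
        bijective_morphism S I J \<alpha>}\<rparr>"

text \<open>
  From here on \<open>T\<close> is an arbitrary structure; the notions have their intended meaning when \<open>T\<close> is an
  inverse monoid, for \<open>semigroup_zero\<close>, \<open>essential\<close> and \<open>essential_part\<close> an inverse monoid with zero.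
  The inverse is the semigroup-theoretic one, not the group-like \<open>m_inv\<close>.
\<close>

definition semigroup_zero :: "('c, 'd) monoid_scheme \<Rightarrow> 'c" where
  "semigroup_zero T =
    (THE z. z \<in> carrier T \<and> (\<forall>x\<in>carrier T. z \<otimes>\<^bsub>T\<^esub> x = z \<and> x \<otimes>\<^bsub>T\<^esub> z = z))"

definition semigroup_inv :: "('c, 'd) monoid_scheme \<Rightarrow> 'c \<Rightarrow> 'c" where
  "semigroup_inv T s =
    (THE t. t \<in> carrier T \<and> s \<otimes>\<^bsub>T\<^esub> t \<otimes>\<^bsub>T\<^esub> s = s \<and> t \<otimes>\<^bsub>T\<^esub> s \<otimes>\<^bsub>T\<^esub> t = t)"

definition idempotents :: "('c, 'd) monoid_scheme \<Rightarrow> 'c set" where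
  "idempotents T = {e \<in> carrier T. e \<otimes>\<^bsub>T\<^esub> e = e}"

definition essential :: "('c, 'd) monoid_scheme \<Rightarrow> 'c \<Rightarrow> bool" where
  "essential T e \<longleftrightarrow>
    e \<in> idempotents T \<and> e \<noteq> semigroup_zero T \<and>
    (\<forall>f\<in>idempotents T. f \<noteq> semigroup_zero T \<longrightarrow> e \<otimes>\<^bsub>T\<^esub> f \<noteq> semigroup_zero T)"

definition essential_part :: "('c, 'd) monoid_scheme \<Rightarrow> ('c, 'd) monoid_scheme" where
  "essential_part T = T
    \<lparr>carrier := {s \<in> carrier T.
      essential T (semigroup_inv T s \<otimes>\<^bsub>T\<^esub> s) \<and> essential T (s \<otimes>\<^bsub>T\<^esub> semigroup_inv T s)}\<rparr>"

definition natural_le :: "('c, 'd) monoid_scheme \<Rightarrow> 'c \<Rightarrow> 'c \<Rightarrow> bool" where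
  "natural_le T s t \<longleftrightarrow> (\<exists>e\<in>idempotents T. s = t \<otimes>\<^bsub>T\<^esub> e)"

definition min_group_cong :: "('c, 'd) monoid_scheme \<Rightarrow> ('c \<times> 'c) set" where
  "min_group_cong T =
    {(s, t). s \<in> carrier T \<and> t \<in> carrier T \<and>
      (\<exists>u\<in>carrier T. natural_le T u s \<and> natural_le T u t)}"

text \<open>
  The set product of two congruence classes is in general only contained in a class; taking its
  image under the congruence gives the class of the product of representatives.
\<close>

definition min_group_quotient :: "('c, 'd) monoid_scheme \<Rightarrow> 'c set monoid" where
  "min_group_quotient T =
    \<lparr>carrier = carrier T // min_group_cong T,
     mult = (\<lambda>A B. min_group_cong T `` (A <#>\<^bsub>T\<^esub> B)),
     one = min_group_cong T `` {\<one>\<^bsub>T\<^esub>}\<rparr>"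

end

theory Submission imports Defs begin

text \<open>
  Write \<open>tail n\<close> for the set of all elements whose degree is at least \<open>n\<close>. By unique factorization it
  is the right ideal generated by the elements of degree exactly \<open>n\<close>. These are finitely many because
  the alphabets are finite, there is at least one because the alphabets are non-empty, and distinct
  ones are incomparable. So every tail is a projective right ideal, and it is essential: every
  element can be multiplied into it.

  Conversely, every essential finitely generated right ideal \<open>XS\<close> contains a tail
  (\<open>dense_generated_contains_tail\<close>). If the degree of \<open>c\<close> is at least that of every element of \<open>X\<close>
  and \<open>cs = xt\<close> with \<open>x \<in> X\<close>, then the prefix of \<open>c\<close> of degree \<open>d x\<close> must be \<open>x\<close>, so \<open>c\<close> already lies
  in \<open>XS\<close>. Thus the tails form a cofinal system of essential ideals, for projective ideals as well
  as for finitely generated ones.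

  It follows that in both inverse monoids two elements of the essential part are \<open>\<sigma>\<close>-related
  exactly if they are defined and agree on some tail (\<open>min_group_cong_Me\<close>), so that the congruence
  for projective ideals is the restriction of the one for finitely generated ideals. Moreover, a
  bijective morphism with essential domain and image can be restricted to a tail in its domain;
  the restriction again has an essential image, which is projective because bijective
  morphisms preserve incomparability. Hence every class of the larger quotient meets the smaller
  monoid, and the inclusion induces the isomorphism.

  Since the two cases differ only in the class of ideals, the argument is carried out for a family
  \<open>F\<close> of right ideals that has the closure properties collected in the locale \<open>ideal_family\<close>, and
  the isomorphism is obtained for any two such families one of which contains the other.
\<close>

section \<open>Right ideals\<close>

lemma (in monoid) set_mult_carrier_iff:
  "x \<in> X <#> carrier G \<longleftrightarrow> (\<exists>a\<in>X. \<exists>s\<in>carrier G. x = a \<otimes> s)"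
  by (auto simp: set_mult_def)

definition right_ideal :: "('a, 'b) monoid_scheme \<Rightarrow> 'a set \<Rightarrow> bool" where
  "right_ideal S I \<longleftrightarrow> I \<subseteq> carrier S \<and> (\<forall>a\<in>I. \<forall>s\<in>carrier S. a \<otimes>\<^bsub>S\<^esub> s \<in> I)"

text \<open>
  For right ideals this says that the ideal meets every non-empty right ideal: it is essentiality
  of the corresponding idempotent, expressed in terms of elements.
\<close>

definition dense_ideal :: "('a, 'b) monoid_scheme \<Rightarrow> 'a set \<Rightarrow> bool" where
  "dense_ideal S I \<longleftrightarrow> (\<forall>a\<in>carrier S. \<exists>s\<in>carrier S. a \<otimes>\<^bsub>S\<^esub> s \<in> I)"

lemma (in monoid) right_ideal_generated: "X \<subseteq> carrier G \<Longrightarrow> right_ideal G (X <#> carrier G)"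
  unfolding right_ideal_def by (fastforce simp: set_mult_carrier_iff m_assoc subset_iff)

lemma (in monoid) dense_ideal_Int:
  assumes "right_ideal G I" "dense_ideal G I" "dense_ideal G J"
  shows "dense_ideal G (I \<inter> J)"
  unfolding dense_ideal_def
proof
  fix a assume a: "a \<in> carrier G"
  then obtain s where s: "s \<in> carrier G" "a \<otimes> s \<in> I"
    using assms(2) unfolding dense_ideal_def by blast
  then obtain t where t: "t \<in> carrier G" "a \<otimes> s \<otimes> t \<in> J"
    using assms(3) a unfolding dense_ideal_def by blast
  have "a \<otimes> (s \<otimes> t) \<in> I \<inter> J"
    using s t a assms(1) unfolding right_ideal_def by (simp add: m_assoc[symmetric])
  then show "\<exists>s\<in>carrier G. a \<otimes> s \<in> I \<inter> J" using s t by blast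
qed

lemma comparable_iff:
  "comparable S x y \<longleftrightarrow> (\<exists>s\<in>carrier S. \<exists>t\<in>carrier S. x \<otimes>\<^bsub>S\<^esub> s = y \<otimes>\<^bsub>S\<^esub> t)"
  unfolding comparable_def l_coset_def by blast


section \<open>Bijective morphisms between right ideals\<close>

lemma bijective_morphism_Some_inj:
  "bijective_morphism S I J \<alpha> \<Longrightarrow> \<alpha> x = Some z \<Longrightarrow> \<alpha> y = Some z \<Longrightarrow> x = y"
  unfolding bijective_morphism_def inj_on_def by (metis domI)

lemma bijective_morphism_mult:
  "bijective_morphism S I J \<alpha> \<Longrightarrow> \<alpha> x = Some y \<Longrightarrow> s \<in> carrier S \<Longrightarrow>
    \<alpha> (x \<otimes>\<^bsub>S\<^esub> s) = Some (y \<otimes>\<^bsub>S\<^esub> s)"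
  unfolding bijective_morphism_def by (metis domI option.sel)

lemma bijective_morphismI:
  assumes "dom \<alpha> = I" "ran \<alpha> = J"
    and "\<And>x y z. \<alpha> x = Some z \<Longrightarrow> \<alpha> y = Some z \<Longrightarrow> x = y"
    and "\<And>x y s. \<alpha> x = Some y \<Longrightarrow> s \<in> carrier S \<Longrightarrow> \<alpha> (x \<otimes>\<^bsub>S\<^esub> s) = Some (y \<otimes>\<^bsub>S\<^esub> s)"
  shows "bijective_morphism S I J \<alpha>"
  unfolding bijective_morphism_def inj_on_def using assms by (metis domD option.sel)

lemma bijective_morphism_dom: "bijective_morphism S I J \<alpha> \<Longrightarrow> dom \<alpha> = I"
  and bijective_morphism_ran: "bijective_morphism S I J \<alpha> \<Longrightarrow> ran \<alpha> = J"
  by (auto simp: bijective_morphism_def)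

text \<open>
  The inverse is described by its graph, which also settles where it is undefined and lets it be
  compared with other partial functions by extensionality.
\<close>

lemma bijective_morphism_converse:
  assumes "bijective_morphism S I J \<alpha>"
  obtains \<beta> where "bijective_morphism S J I \<beta>" "\<And>x y. \<beta> y = Some x \<longleftrightarrow> \<alpha> x = Some y"
proof -
  define \<beta> where "\<beta> = (\<lambda>y. if \<exists>x. \<alpha> x = Some y then Some (THE x. \<alpha> x = Some y) else None)"
  have eq: "\<beta> y = Some x \<longleftrightarrow> \<alpha> x = Some y" for x y
  proof -
    have "(THE x. \<alpha> x = Some y) = x" if "\<alpha> x = Some y" for x
      using that bijective_morphism_Some_inj[OF assms] by blast
    then show ?thesis unfolding \<beta>_def by auto
  qed
  have "bijective_morphism S J I \<beta>"
  proof (rule bijective_morphismI)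
    show "dom \<beta> = J" using bijective_morphism_ran[OF assms] by (auto simp: dom_def ran_def eq)
    show "ran \<beta> = I" using bijective_morphism_dom[OF assms] by (auto simp: dom_def ran_def eq)
  qed (auto simp: eq intro: bijective_morphism_mult[OF assms])
  then show ?thesis using eq that by blast
qed

lemma bijective_morphism_restrict:
  assumes "bijective_morphism S I J \<alpha>" "right_ideal S K" "K \<subseteq> I"
  shows "bijective_morphism S K ((the \<circ> \<alpha>) ` K) (\<alpha> |` K)"
proof (rule bijective_morphismI)
  have dom: "dom \<alpha> = I" by (rule bijective_morphism_dom[OF assms(1)])
  then show "dom (\<alpha> |` K) = K" using assms(3) by auto
  show "ran (\<alpha> |` K) = (the \<circ> \<alpha>) ` K"
    using dom assms(3) by (force simp: ran_def restrict_map_def image_iff)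
  show "x = y" if "(\<alpha> |` K) x = Some z" "(\<alpha> |` K) y = Some z" for x y z
    using that bijective_morphism_Some_inj[OF assms(1)]
    by (auto simp: restrict_map_def split: if_splits)
  show "(\<alpha> |` K) (x \<otimes>\<^bsub>S\<^esub> s) = Some (y \<otimes>\<^bsub>S\<^esub> s)"
    if "(\<alpha> |` K) x = Some y" "s \<in> carrier S" for x y s
    using that assms(2) bijective_morphism_mult[OF assms(1)]
    by (auto simp: restrict_map_def right_ideal_def split: if_splits)
qed

lemma bijective_morphism_comp:
  assumes "bijective_morphism S I J \<alpha>" "bijective_morphism S I' J' \<beta>"
  shows "bijective_morphism S (dom (\<alpha> \<circ>\<^sub>m \<beta>)) (ran (\<alpha> \<circ>\<^sub>m \<beta>)) (\<alpha> \<circ>\<^sub>m \<beta>)"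
proof (rule bijective_morphismI)
  show "x = y" if "(\<alpha> \<circ>\<^sub>m \<beta>) x = Some z" "(\<alpha> \<circ>\<^sub>m \<beta>) y = Some z" for x y z
    using that unfolding map_comp_Some_iff
    by (blast dest: bijective_morphism_Some_inj[OF assms(1)] bijective_morphism_Some_inj[OF assms(2)])
  show "(\<alpha> \<circ>\<^sub>m \<beta>) (x \<otimes>\<^bsub>S\<^esub> s) = Some (y \<otimes>\<^bsub>S\<^esub> s)"
    if "(\<alpha> \<circ>\<^sub>m \<beta>) x = Some y" "s \<in> carrier S" for x y s
    using that unfolding map_comp_Some_iff
    by (blast intro: bijective_morphism_mult[OF assms(1)] bijective_morphism_mult[OF assms(2)])
qed auto

lemma bijective_morphism_id: "right_ideal S I \<Longrightarrow> bijective_morphism S I I (Some |` I)"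
  by (rule bijective_morphismI)
    (auto simp: right_ideal_def restrict_map_def ran_def dom_def split: if_splits)

text \<open>
  Density passes to the image because an element \<open>a\<close> can first be multiplied into the dense range \<open>J\<close>;
  the preimage of the result can be multiplied into \<open>K\<close>, and the morphism carries this
  multiplication back to \<open>J\<close>.
\<close>

lemma (in monoid) dense_ideal_image:
  assumes "bijective_morphism G I J \<alpha>" "right_ideal G I"
    and "dense_ideal G J" "dense_ideal G K" "K \<subseteq> I"
  shows "dense_ideal G ((the \<circ> \<alpha>) ` K)"
  unfolding dense_ideal_def
proof
  fix a assume a: "a \<in> carrier G"
  then obtain s where s: "s \<in> carrier G" "a \<otimes> s \<in> J"
    using assms(3) unfolding dense_ideal_def by blast
  then obtain x where x: "\<alpha> x = Some (a \<otimes> s)"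
    using bijective_morphism_ran[OF assms(1)] by (auto simp: ran_def)
  then have "x \<in> carrier G"
    using assms(2) bijective_morphism_dom[OF assms(1)] unfolding right_ideal_def by blast
  then obtain t where t: "t \<in> carrier G" "x \<otimes> t \<in> K"
    using assms(4) unfolding dense_ideal_def by blast
  have "\<alpha> (x \<otimes> t) = Some (a \<otimes> s \<otimes> t)" by (rule bijective_morphism_mult[OF assms(1) x t(1)])
  then have "a \<otimes> s \<otimes> t \<in> (the \<circ> \<alpha>) ` K" using t(2) by (force simp: image_iff)
  then show "\<exists>s\<in>carrier G. a \<otimes> s \<in> (the \<circ> \<alpha>) ` K"
    using a s t by (metis m_assoc m_closed)
qed

lemma (in monoid) image_generators:
  assumes \<alpha>: "bijective_morphism G I J \<alpha>" and J: "right_ideal G J"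
    and X: "X \<subseteq> carrier G" and sub: "X <#> carrier G \<subseteq> I"
  shows "X \<subseteq> I" "(the \<circ> \<alpha>) ` X \<subseteq> carrier G"
    "(the \<circ> \<alpha>) ` (X <#> carrier G) = (the \<circ> \<alpha>) ` X <#> carrier G"
proof -
  show XI: "X \<subseteq> I"
  proof
    fix x assume "x \<in> X"
    then have "x \<otimes> \<one> \<in> X <#> carrier G" unfolding set_mult_carrier_iff by blast
    then show "x \<in> I" using sub X \<open>x \<in> X\<close>
      by (metis r_one subsetD)
  qed
  show "(the \<circ> \<alpha>) ` X \<subseteq> carrier G"
  proof
    fix y assume "y \<in> (the \<circ> \<alpha>) ` X"
    then obtain x where "x \<in> X" "y = the (\<alpha> x)" by auto
    then have "\<alpha> x = Some y" using XI bijective_morphism_dom[OF \<alpha>] by force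
    then show "y \<in> carrier G"
      using bijective_morphism_ran[OF \<alpha>] J unfolding right_ideal_def by (auto intro: ranI)
  qed
  have "the (\<alpha> (x \<otimes> s)) = the (\<alpha> x) \<otimes> s" if "x \<in> X" "s \<in> carrier G" for x s
    using \<alpha> XI that unfolding bijective_morphism_def by (metis option.sel subsetD)
  then show "(the \<circ> \<alpha>) ` (X <#> carrier G) = (the \<circ> \<alpha>) ` X <#> carrier G"
    by (force simp: set_mult_def image_iff)
qed

text \<open>
  A common multiple of \<open>\<alpha> x\<close> and \<open>\<alpha> y\<close> is the image of a common multiple of \<open>x\<close> and \<open>y\<close>, by injectivity.
\<close>

lemma (in monoid) generalized_prefix_code_image:
  assumes \<alpha>: "bijective_morphism G I J \<alpha>" and J: "right_ideal G J"
    and X: "generalized_prefix_code G X" and sub: "X <#> carrier G \<subseteq> I"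
  shows "generalized_prefix_code G ((the \<circ> \<alpha>) ` X)"
proof -
  have XG: "X \<subseteq> carrier G" using X unfolding generalized_prefix_code_def by blast
  note gen = image_generators[OF \<alpha> J XG sub]
  have "\<not> comparable G (the (\<alpha> x)) (the (\<alpha> y))"
    if xy: "x \<in> X" "y \<in> X" "the (\<alpha> x) \<noteq> the (\<alpha> y)" for x y
  proof
    assume "comparable G (the (\<alpha> x)) (the (\<alpha> y))"
    then obtain s t where st: "s \<in> carrier G" "t \<in> carrier G"
      "the (\<alpha> x) \<otimes> s = the (\<alpha> y) \<otimes> t" unfolding comparable_iff by blast
    have "\<alpha> (x \<otimes> s) = Some (the (\<alpha> x) \<otimes> s)" "\<alpha> (y \<otimes> t) = Some (the (\<alpha> y) \<otimes> t)"
      using \<alpha> gen(1) xy(1,2) st(1,2) unfolding bijective_morphism_def by blast+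
    then have "x \<otimes> s = y \<otimes> t" using st(3) bijective_morphism_Some_inj[OF \<alpha>] by metis
    then have "comparable G x y" using st unfolding comparable_iff by blast
    then have "x = y" using X xy unfolding generalized_prefix_code_def by blast
    then show False using xy(3) by simp
  qed
  then show ?thesis using X gen(2) unfolding generalized_prefix_code_def by auto
qed

lemma map_comp_restrict_id: "(Some |` I) \<circ>\<^sub>m (Some |` J) = Some |` (I \<inter> J)"
  by (auto simp: map_comp_def restrict_map_def fun_eq_iff)

lemma restrict_id_eq_empty_iff: "Some |` I = Map.empty \<longleftrightarrow> I = {}"
  by (auto simp: restrict_map_def fun_eq_iff split: if_splits)

lemma map_comp_restrict_right: "\<alpha> \<circ>\<^sub>m (Some |` I) = \<alpha> |` I"
  by (auto simp: map_comp_def restrict_map_def fun_eq_iff)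


section \<open>Levels and tails of a k-monoid\<close>

context k_monoid
begin

definition level :: "nat ^ 'k \<Rightarrow> 'a set" where
  "level n = {x \<in> carrier S. d x = n}"

text \<open>
  The condition \<open>\<exists>r. d x = n + r\<close> is the componentwise order \<open>n \<le> d x\<close>, in the form in which unique
  factorization applies to it.
\<close>

definition tail :: "nat ^ 'k \<Rightarrow> 'a set" where
  "tail n = {x \<in> carrier S. \<exists>r. d x = n + r}"

lemma factorization_exists:
  assumes "x \<in> carrier S" "d x = m + n"
  obtains y z where "y \<in> carrier S" "z \<in> carrier S" "x = y \<otimes> z" "d y = m" "d z = n"
  using ex1_implies_ex[OF unique_factorization[OF assms]] by auto

lemma factorization_unique:
  assumes "x \<in> carrier S" "y \<in> carrier S" "x' \<in> carrier S" "y' \<in> carrier S"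
    and "x \<otimes> y = x' \<otimes> y'" "d x = d x'"
  shows "x = x'" "y = y'"
proof -
  have "d x + d y = d x' + d y'" using assms degree_mult by metis
  then have "d y = d y'" using assms by simp
  moreover have "d (x \<otimes> y) = d x + d y" "x \<otimes> y \<in> carrier S"
    using assms(1,2) by (simp_all add: degree_mult)
  ultimately have "\<exists>!(u, v). u \<in> carrier S \<and> v \<in> carrier S \<and> x \<otimes> y = u \<otimes> v \<and>
      d u = d x \<and> d v = d y" (is "\<exists>!q. ?P q")
    by (intro unique_factorization)
  then have uniq: "q = q'" if "?P q" "?P q'" for q q'
    using that by blast
  have "(x, y) = (x', y')"
    by (rule uniq) (use assms \<open>d y = d y'\<close> in auto)
  then show "x = x'" "y = y'" by auto
qed

text \<open>
  Of two prefixes of one element, the one of componentwise smaller degree is a prefix of the other. This is the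
  substitute for comparing prefixes of a word, and both the description of intersections of ideals
  and the cofinality of tails rest on it.
\<close>

lemma prefix_of_longer_prefix:
  assumes "a \<in> carrier S" "s \<in> carrier S" "w \<in> carrier S" "q \<in> carrier S"
    and "a \<otimes> s = w \<otimes> q" "d w = d a + u"
  obtains v where "v \<in> carrier S" "w = a \<otimes> v"
proof -
  obtain a' v where v: "a' \<in> carrier S" "v \<in> carrier S" "w = a' \<otimes> v" "d a' = d a"
    using factorization_exists[OF assms(3,6)] by blast
  have "a' \<otimes> (v \<otimes> q) = a \<otimes> s" using assms v by (simp add: m_assoc)
  then have "a' = a" using factorization_unique(1)[of a' "v \<otimes> q" a s] v assms by simp
  then show ?thesis using v that by blast
qed

lemma comparable_same_degree:
  "x \<in> carrier S \<Longrightarrow> y \<in> carrier S \<Longrightarrow> comparable S x y \<Longrightarrow> d x = d y \<Longrightarrow> x = y"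
  unfolding comparable_iff using factorization_unique(1) by blast

lemma degree_zero_imp_one: "x \<in> carrier S \<Longrightarrow> d x = 0 \<Longrightarrow> x = \<one>"
  using factorization_unique(1)[of x \<one> \<one> x] degree_one by simp

lemma level_add: "level (m + n) = level m <#> level n"
proof
  show "level (m + n) \<subseteq> level m <#> level n"
  proof
    fix x assume "x \<in> level (m + n)"
    then have "x \<in> carrier S" "d x = m + n" by (auto simp: level_def)
    then obtain y z where "y \<in> carrier S" "z \<in> carrier S" "x = y \<otimes> z" "d y = m" "d z = n"
      by (rule factorization_exists)
    then show "x \<in> level m <#> level n" by (auto simp: level_def set_mult_def)
  qed
  show "level m <#> level n \<subseteq> level (m + n)"
    unfolding level_def set_mult_def using degree_mult by auto
qed

lemma tail_eq_generated: "tail n = level n <#> carrier S"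
proof
  show "tail n \<subseteq> level n <#> carrier S"
  proof
    fix x assume "x \<in> tail n"
    then obtain r where "x \<in> carrier S" "d x = n + r" by (auto simp: tail_def)
    then obtain y z where "y \<in> carrier S" "z \<in> carrier S" "x = y \<otimes> z" "d y = n"
      using factorization_exists by metis
    then show "x \<in> level n <#> carrier S" by (auto simp: level_def set_mult_def)
  qed
  show "level n <#> carrier S \<subseteq> tail n"
    unfolding tail_def level_def set_mult_def using degree_mult by auto
qed

lemma tail_add_subset: "tail (m + n) \<subseteq> tail m" "tail (m + n) \<subseteq> tail n"
  unfolding tail_def by (auto simp: add.assoc, metis add.left_commute)

end

locale finite_k_monoid = k_monoid +
  assumes alphabet_finite: "finite (alphabet S d i)"
    and alphabet_nonempty: "alphabet S d i \<noteq> {}"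
begin

text \<open>
  An element of degree \<open>n\<close> is a product of as many letters from the alphabets as the sum of the
  coordinates of \<open>n\<close> says; the induction splits off one letter.
\<close>

lemma level_finite_nonempty: "finite (level n) \<and> level n \<noteq> {}"
proof (induction "\<Sum>i\<in>UNIV. n $ i" arbitrary: n)
  case 0
  then have "n = 0" by (simp add: vec_eq_iff)
  then have "level n = {\<one>}" using degree_zero_imp_one degree_one by (auto simp: level_def)
  then show ?case by simp
next
  case (Suc p)
  then have "\<exists>i. n $ i \<noteq> 0" by (metis nat.distinct(1) sum.neutral)
  then obtain i where i: "n $ i \<noteq> 0" by blast
  define m where "m = (\<chi> j. n $ j - axis i 1 $ j)"
  have n: "n = axis i 1 + m" using i by (auto simp: m_def vec_eq_iff axis_def)
  have "(\<Sum>j\<in>UNIV. n $ j) = (\<Sum>j\<in>UNIV. axis i 1 $ j) + (\<Sum>j\<in>UNIV. m $ j)"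
    by (subst n) (simp add: sum.distrib)
  moreover have "(\<Sum>j\<in>UNIV. axis i (1::nat) $ j) = 1" by (simp add: axis_def)
  ultimately have IH: "finite (level m) \<and> level m \<noteq> {}" using Suc by simp
  have "level (axis i 1) = alphabet S d i" by (simp add: level_def alphabet_def)
  then have eq: "level n = alphabet S d i <#> level m" unfolding n level_add by simp
  show ?case using IH alphabet_finite[of i] alphabet_nonempty[of i]
    unfolding eq set_mult_def by auto
qed

lemma level_prefix_code: "generalized_prefix_code S (level n)"
  unfolding generalized_prefix_code_def using level_finite_nonempty[of n] comparable_same_degree
  by (auto simp: level_def)

lemma dense_ideal_tail: "dense_ideal S (tail n)"
  unfolding dense_ideal_def
proof
  fix a assume a: "a \<in> carrier S"
  obtain c where c: "c \<in> carrier S" "d c = n"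
    using level_finite_nonempty[of n] by (auto simp: level_def)
  then have "a \<otimes> c \<in> tail n" using a degree_mult by (auto simp: tail_def add.commute)
  then show "\<exists>s\<in>carrier S. a \<otimes> s \<in> tail n" using c by blast
qed

text \<open>
  The sum of the degrees of the generators serves as a common upper bound; any other would do.
  An element \<open>c\<close> that is at least as long as every generator cannot have a common multiple with a
  generator without extending it.
\<close>

lemma dense_generated_contains_tail:
  assumes "finite X" "X \<subseteq> carrier S" "dense_ideal S (X <#> carrier S)"
  shows "tail (\<Sum>x\<in>X. d x) \<subseteq> X <#> carrier S"
proof
  fix c assume "c \<in> tail (\<Sum>x\<in>X. d x)"
  then obtain r where c: "c \<in> carrier S" "d c = (\<Sum>x\<in>X. d x) + r" by (auto simp: tail_def)
  obtain s x t where st: "s \<in> carrier S" "x \<in> X" "t \<in> carrier S" "c \<otimes> s = x \<otimes> t"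
    using assms(3) c(1) unfolding dense_ideal_def set_mult_carrier_iff by blast
  have "d c = d x + ((\<Sum>y\<in>X-{x}. d y) + r)"
    using c(2) sum.remove[OF assms(1) st(2), of d] by (simp add: add.assoc)
  then obtain v where "v \<in> carrier S" "c = x \<otimes> v"
    using prefix_of_longer_prefix[of x t c s] st c assms(2) by auto
  then show "c \<in> X <#> carrier S" using st(2) by (auto simp: set_mult_carrier_iff)
qed

text \<open>
  The minimal common multiples of pairs in \<open>X \<times> Y\<close>: a common multiple of \<open>x\<close> and \<open>y\<close> has degree at least the
  join of \<open>d x\<close> and \<open>d y\<close>, and its prefix whose degree is the join is again a common multiple.
\<close>

definition common_multiples :: "'a set \<Rightarrow> 'a set \<Rightarrow> 'a set" where
  "common_multiples X Y = (\<Union>x\<in>X. \<Union>y\<in>Y.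
    {w \<in> level (\<chi> i. max (d x $ i) (d y $ i)).
      (\<exists>s\<in>carrier S. w = x \<otimes> s) \<and> (\<exists>t\<in>carrier S. w = y \<otimes> t)})"

lemma common_multiples_carrier: "common_multiples X Y \<subseteq> carrier S"
  by (auto simp: common_multiples_def level_def)

lemma finite_common_multiples: "finite X \<Longrightarrow> finite Y \<Longrightarrow> finite (common_multiples X Y)"
  unfolding common_multiples_def using level_finite_nonempty by simp

lemma Int_generated:
  assumes "X \<subseteq> carrier S" "Y \<subseteq> carrier S"
  shows "(X <#> carrier S) \<inter> (Y <#> carrier S) = common_multiples X Y <#> carrier S"
proof
  show "common_multiples X Y <#> carrier S \<subseteq> (X <#> carrier S) \<inter> (Y <#> carrier S)"
  proof
    fix z assume "z \<in> common_multiples X Y <#> carrier S"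
    then obtain w x y s t q where
      "x \<in> X" "y \<in> Y" "s \<in> carrier S" "t \<in> carrier S" "q \<in> carrier S"
      "z = w \<otimes> q" "w = x \<otimes> s" "w = y \<otimes> t"
      unfolding common_multiples_def set_mult_carrier_iff by blast
    then have "z = x \<otimes> (s \<otimes> q)" "z = y \<otimes> (t \<otimes> q)" "s \<otimes> q \<in> carrier S" "t \<otimes> q \<in> carrier S"
      using assms by (auto simp: m_assoc[symmetric])
    then show "z \<in> (X <#> carrier S) \<inter> (Y <#> carrier S)"
      using \<open>x \<in> X\<close> \<open>y \<in> Y\<close> unfolding set_mult_carrier_iff Int_iff by blast
  qed
  show "(X <#> carrier S) \<inter> (Y <#> carrier S) \<subseteq> common_multiples X Y <#> carrier S"
  proof
    fix z assume "z \<in> (X <#> carrier S) \<inter> (Y <#> carrier S)"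
    then obtain x s y t where z: "x \<in> X" "y \<in> Y" "s \<in> carrier S" "t \<in> carrier S"
      "z = x \<otimes> s" "z = y \<otimes> t" unfolding set_mult_carrier_iff Int_iff by blast
    have xy: "x \<in> carrier S" "y \<in> carrier S" using z assms by auto
    define j where "j = (\<chi> i. max (d x $ i) (d y $ i))"
    have dz: "d z = d x + d s" "d z = d y + d t"
      using degree_mult[OF xy(1) z(3)] degree_mult[OF xy(2) z(4)] z(5,6) by metis+
    have "d z = j + (\<chi> i. d z $ i - j $ i)"
    proof (simp add: vec_eq_iff, intro allI)
      fix i
      have "d z $ i = d x $ i + d s $ i" "d z $ i = d y $ i + d t $ i"
        using dz by (metis vector_add_component)+
      then show "d z $ i = j $ i + (d z $ i - j $ i)" by (simp add: j_def)
    qed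
    moreover have "z \<in> carrier S" using z xy by simp
    ultimately obtain w q where w: "w \<in> carrier S" "q \<in> carrier S" "z = w \<otimes> q" "d w = j"
      using factorization_exists by metis
    have "d w = d x + (\<chi> i. j $ i - d x $ i)" "d w = d y + (\<chi> i. j $ i - d y $ i)"
      unfolding w(4) by (auto simp: j_def vec_eq_iff)
    then have "\<exists>v\<in>carrier S. w = x \<otimes> v" "\<exists>v\<in>carrier S. w = y \<otimes> v"
      using prefix_of_longer_prefix[of x s w q] prefix_of_longer_prefix[of y t w q] z xy w
      by metis+
    then have "w \<in> common_multiples X Y"
      using z w unfolding common_multiples_def level_def j_def by blast
    then show "z \<in> common_multiples X Y <#> carrier S"
      using w unfolding set_mult_carrier_iff by blast
  qed
qed

text \<open>
  Comparable minimal common multiples come from comparable, hence equal, elements of \<open>X\<close> and of \<open>Y\<close>;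
  then their degrees are equal, and comparable elements of equal degree coincide.
\<close>

lemma common_multiples_incomparable:
  assumes X: "generalized_prefix_code S X" and Y: "generalized_prefix_code S Y"
    and w: "w \<in> common_multiples X Y" and w': "w' \<in> common_multiples X Y"
    and "comparable S w w'"
  shows "w = w'"
proof -
  obtain x y s t where xy: "x \<in> X" "y \<in> Y" "w \<in> level (\<chi> i. max (d x $ i) (d y $ i))"
    "s \<in> carrier S" "w = x \<otimes> s" "t \<in> carrier S" "w = y \<otimes> t"
    using w unfolding common_multiples_def by blast
  obtain x' y' s' t' where xy': "x' \<in> X" "y' \<in> Y" "w' \<in> level (\<chi> i. max (d x' $ i) (d y' $ i))"
    "s' \<in> carrier S" "w' = x' \<otimes> s'" "t' \<in> carrier S" "w' = y' \<otimes> t'"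
    using w' unfolding common_multiples_def by blast
  obtain p q where pq: "p \<in> carrier S" "q \<in> carrier S" "w \<otimes> p = w' \<otimes> q"
    using assms(5) unfolding comparable_iff by blast
  have c: "x \<in> carrier S" "y \<in> carrier S" "x' \<in> carrier S" "y' \<in> carrier S"
    using X Y xy xy' unfolding generalized_prefix_code_def by auto
  have "x \<otimes> (s \<otimes> p) = x' \<otimes> (s' \<otimes> q)" using pq xy(4,5) xy'(4,5) c by (simp add: m_assoc)
  then have "comparable S x x'" using pq xy xy' m_closed unfolding comparable_iff by blast
  then have "x = x'" using X xy xy' unfolding generalized_prefix_code_def by blast
  have "y \<otimes> (t \<otimes> p) = y' \<otimes> (t' \<otimes> q)"
    using pq xy(6) xy'(6) c by (simp add: m_assoc[symmetric] flip: xy(7) xy'(7))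
  then have "comparable S y y'" using pq xy xy' m_closed unfolding comparable_iff by blast
  then have "y = y'" using Y xy xy' unfolding generalized_prefix_code_def by blast
  then show ?thesis
    using comparable_same_degree[of w w'] xy(3) xy'(3) assms(5) \<open>x = x'\<close>
    unfolding level_def by auto
qed

end


section \<open>Inverse monoids of morphisms between ideals of a given family\<close>

definition morphism_monoid :: "('a, 'b) monoid_scheme \<Rightarrow> 'a set set \<Rightarrow> ('a \<rightharpoonup> 'a) monoid" where
  "morphism_monoid S F =
    \<lparr>carrier = {\<alpha>. \<exists>I\<in>F. \<exists>J\<in>F. bijective_morphism S I J \<alpha>},
     mult = (\<circ>\<^sub>m),
     one = Some |` carrier S\<rparr>"

text \<open>
  The properties shared by the finitely generated right ideals and by the projective ones, the
  empty ideal included. The closure under images concerns bijective morphisms between arbitrary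
  right ideals: to restrict a morphism from a larger family to a tail, the image of the tail is
  needed in \<open>F\<close> although the domain and the range of the morphism need not belong to \<open>F\<close>.
\<close>

locale ideal_family = finite_k_monoid S d
  for S :: "('a, 'b) monoid_scheme" (structure) and d :: "'a \<Rightarrow> nat ^ 'k" +
  fixes F :: "'a set set"
  assumes right_ideal: "I \<in> F \<Longrightarrow> right_ideal S I"
    and empty_mem: "{} \<in> F"
    and principal_mem: "a \<in> carrier S \<Longrightarrow> {a} <#> carrier S \<in> F"
    and Int_mem: "I \<in> F \<Longrightarrow> J \<in> F \<Longrightarrow> I \<inter> J \<in> F"
    and image_mem: "\<lbrakk>bijective_morphism S I J \<alpha>; right_ideal S J; K \<in> F; K \<subseteq> I\<rbrakk>
      \<Longrightarrow> (the \<circ> \<alpha>) ` K \<in> F"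
    and tail_mem: "tail n \<in> F"
    and dense_contains_tail: "I \<in> F \<Longrightarrow> dense_ideal S I \<Longrightarrow> \<exists>n. tail n \<subseteq> I"
begin

abbreviation "M \<equiv> morphism_monoid S F"
abbreviation "Me \<equiv> essential_part M"

lemma carrier_M: "\<alpha> \<in> carrier M \<longleftrightarrow> (\<exists>I\<in>F. \<exists>J\<in>F. bijective_morphism S I J \<alpha>)"
  and mult_M: "mult M = (\<circ>\<^sub>m)"
  by (auto simp: morphism_monoid_def)

lemma id_mem: "I \<in> F \<Longrightarrow> Some |` I \<in> carrier M"
  unfolding carrier_M using bijective_morphism_id right_ideal by blast

lemma zero_M: "semigroup_zero M = Map.empty"
  unfolding semigroup_zero_def
proof (rule the_equality)
  have "Some |` {} \<in> carrier M" by (rule id_mem[OF empty_mem])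
  then have mem: "Map.empty \<in> carrier M" by simp
  then show "Map.empty \<in> carrier M \<and>
      (\<forall>x\<in>carrier M. Map.empty \<otimes>\<^bsub>M\<^esub> x = Map.empty \<and> x \<otimes>\<^bsub>M\<^esub> Map.empty = Map.empty)"
    by (auto simp: mult_M map_comp_def fun_eq_iff split: option.split)
  fix z assume "z \<in> carrier M \<and> (\<forall>x\<in>carrier M. z \<otimes>\<^bsub>M\<^esub> x = z \<and> x \<otimes>\<^bsub>M\<^esub> z = z)"
  then have "z \<circ>\<^sub>m Map.empty = z" using mem by (auto simp: mult_M)
  then show "z = Map.empty" by (auto simp: map_comp_def)
qed

text \<open>
  Injectivity allows to cancel in \<open>\<alpha> \<beta> \<alpha> = \<alpha>\<close> pointwise, which makes the converse the only
  semigroup-theoretic inverse.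
\<close>

lemma converse_unique:
  assumes "bijective_morphism S I J \<alpha>" "bijective_morphism S I' J' \<beta>"
    and "\<alpha> \<circ>\<^sub>m \<beta> \<circ>\<^sub>m \<alpha> = \<alpha>" "\<beta> \<circ>\<^sub>m \<alpha> \<circ>\<^sub>m \<beta> = \<beta>"
  shows "\<beta> y = Some x \<longleftrightarrow> \<alpha> x = Some y"
proof -
  have *: "g y = Some x" if fgf: "f \<circ>\<^sub>m g \<circ>\<^sub>m f = f" and f: "bijective_morphism S K L f"
      and fx: "f x = Some y"
    for f g :: "'a \<rightharpoonup> 'a" and K L x y
  proof -
    have "(f \<circ>\<^sub>m g \<circ>\<^sub>m f) x = Some y" using fgf fx by simp
    then obtain z where "g y = Some z" "f z = Some y" using fx by (auto simp: map_comp_Some_iff)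
    then show ?thesis using bijective_morphism_Some_inj[OF f _ fx] by metis
  qed
  show ?thesis using *[OF assms(3,1)] *[OF assms(4,2)] by blast
qed

lemma semigroup_inv_M:
  assumes "I \<in> F" "J \<in> F" "bijective_morphism S I J \<alpha>"
  shows "semigroup_inv M \<alpha> \<circ>\<^sub>m \<alpha> = Some |` I" "\<alpha> \<circ>\<^sub>m semigroup_inv M \<alpha> = Some |` J"
proof -
  obtain \<beta> where \<beta>: "bijective_morphism S J I \<beta>" "\<And>x y. \<beta> y = Some x \<longleftrightarrow> \<alpha> x = Some y"
    using bijective_morphism_converse[OF assms(3)] by blast
  have \<beta>\<alpha>: "\<beta> \<circ>\<^sub>m \<alpha> = Some |` I"
  proof
    fix x show "(\<beta> \<circ>\<^sub>m \<alpha>) x = (Some |` I) x"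
      using bijective_morphism_dom[OF assms(3)] \<beta>(2)
      by (cases "\<alpha> x") (auto simp: map_comp_def restrict_map_def)
  qed
  have \<alpha>\<beta>: "\<alpha> \<circ>\<^sub>m \<beta> = Some |` J"
  proof
    fix y show "(\<alpha> \<circ>\<^sub>m \<beta>) y = (Some |` J) y"
    proof (cases "\<beta> y")
      case None
      then show ?thesis using bijective_morphism_dom[OF \<beta>(1)] by (auto simp: map_comp_def restrict_map_def)
    next
      case (Some x)
      then have "y \<in> J" "\<alpha> x = Some y" using bijective_morphism_dom[OF \<beta>(1)] \<beta>(2) by blast+
      then show ?thesis using Some by (simp add: map_comp_def)
    qed
  qed
  have "semigroup_inv M \<alpha> = \<beta>"
    unfolding semigroup_inv_def mult_M
  proof (rule the_equality)
    have "\<beta> \<in> carrier M" using \<beta>(1) assms unfolding carrier_M by blast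
    moreover have "(Some |` J) \<circ>\<^sub>m \<alpha> = \<alpha>"
      using bijective_morphism_ran[OF assms(3)]
      by (auto simp: fun_eq_iff map_comp_def restrict_map_def ran_def split: option.split)
    moreover have "(Some |` I) \<circ>\<^sub>m \<beta> = \<beta>"
      using bijective_morphism_ran[OF \<beta>(1)]
      by (auto simp: fun_eq_iff map_comp_def restrict_map_def ran_def split: option.split)
    ultimately show "\<beta> \<in> carrier M \<and> \<alpha> \<circ>\<^sub>m \<beta> \<circ>\<^sub>m \<alpha> = \<alpha> \<and> \<beta> \<circ>\<^sub>m \<alpha> \<circ>\<^sub>m \<beta> = \<beta>"
      using \<alpha>\<beta> \<beta>\<alpha> by simp
    fix \<gamma> assume \<gamma>: "\<gamma> \<in> carrier M \<and> \<alpha> \<circ>\<^sub>m \<gamma> \<circ>\<^sub>m \<alpha> = \<alpha> \<and> \<gamma> \<circ>\<^sub>m \<alpha> \<circ>\<^sub>m \<gamma> = \<gamma>"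
    then obtain I' J' where "bijective_morphism S I' J' \<gamma>" unfolding carrier_M by blast
    then have "\<gamma> y = Some x \<longleftrightarrow> \<alpha> x = Some y" for x y
      using converse_unique[OF assms(3)] \<gamma> by blast
    then have "\<gamma> y = Some x \<longleftrightarrow> \<beta> y = Some x" for x y using \<beta>(2) by blast
    then show "\<gamma> = \<beta>" by (metis not_Some_eq ext)
  qed
  then show "semigroup_inv M \<alpha> \<circ>\<^sub>m \<alpha> = Some |` I" "\<alpha> \<circ>\<^sub>m semigroup_inv M \<alpha> = Some |` J"
    using \<alpha>\<beta> \<beta>\<alpha> by auto
qed

lemma idempotent_eq_id:
  assumes "bijective_morphism S I J e" "e \<circ>\<^sub>m e = e"
  shows "e = Some |` I"
proof
  fix x
  show "e x = (Some |` I) x"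
  proof (cases "e x")
    case None
    then show ?thesis using bijective_morphism_dom[OF assms(1)] by (auto simp: restrict_map_def)
  next
    case (Some y)
    then have "(e \<circ>\<^sub>m e) x = Some y" using assms(2) by simp
    then have "e y = Some y" using Some by (auto simp: map_comp_Some_iff)
    then have "x = y" using Some bijective_morphism_Some_inj[OF assms(1)] by blast
    moreover have "x \<in> I" using Some bijective_morphism_dom[OF assms(1)] by blast
    ultimately show ?thesis using Some by simp
  qed
qed

lemma idempotents_M: "idempotents M = (\<lambda>I. Some |` I) ` F"
proof
  show "idempotents M \<subseteq> (\<lambda>I. Some |` I) ` F"
  proof
    fix e assume "e \<in> idempotents M"
    then obtain I J where "I \<in> F" "bijective_morphism S I J e" "e \<circ>\<^sub>m e = e"
      unfolding idempotents_def carrier_M by (auto simp: mult_M carrier_M)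
    then show "e \<in> (\<lambda>I. Some |` I) ` F" using idempotent_eq_id by blast
  qed
  show "(\<lambda>I. Some |` I) ` F \<subseteq> idempotents M"
    unfolding idempotents_def using id_mem by (auto simp: mult_M map_comp_restrict_id)
qed

text \<open>
  The ideals \<open>aS\<close> belong to \<open>F\<close> and every non-empty right ideal contains one of them, so it is enough
  to test essentiality against these.
\<close>

lemma essential_id_iff:
  assumes "I \<in> F"
  shows "essential M (Some |` I) \<longleftrightarrow> dense_ideal S I"
proof
  assume ess: "essential M (Some |` I)"
  show "dense_ideal S I" unfolding dense_ideal_def
  proof
    fix a assume a: "a \<in> carrier S"
    let ?A = "{a} <#> carrier S"
    have "a \<otimes> \<one> \<in> ?A" using a unfolding set_mult_carrier_iff by blast
    then have "Some |` ?A \<in> idempotents M" "Some |` ?A \<noteq> Map.empty"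
      using principal_mem[OF a] by (auto simp: idempotents_M restrict_id_eq_empty_iff)
    then have "(Some |` I) \<circ>\<^sub>m (Some |` ?A) \<noteq> Map.empty"
      using ess unfolding essential_def zero_M mult_M by blast
    then have "I \<inter> ?A \<noteq> {}" by (simp add: map_comp_restrict_id restrict_id_eq_empty_iff)
    then show "\<exists>s\<in>carrier S. a \<otimes> s \<in> I" by (auto simp: set_mult_carrier_iff)
  qed
next
  assume dense: "dense_ideal S I"
  have meets: "I \<inter> J \<noteq> {}" if J: "J \<in> F" and "J \<noteq> {}" for J
  proof -
    obtain a where a: "a \<in> J" using \<open>J \<noteq> {}\<close> by blast
    then have "a \<in> carrier S" using right_ideal[OF J] unfolding right_ideal_def by blast
    then obtain s where "s \<in> carrier S" "a \<otimes> s \<in> I" using dense unfolding dense_ideal_def by blast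
    then show ?thesis using a right_ideal[OF J] unfolding right_ideal_def by blast
  qed
  have "I \<noteq> {}" using dense one_closed unfolding dense_ideal_def by blast
  then show "essential M (Some |` I)"
    unfolding essential_def zero_M idempotents_M mult_M using assms meets
    by (auto simp: map_comp_restrict_id restrict_id_eq_empty_iff)
qed

lemma carrier_Me:
  "\<alpha> \<in> carrier Me \<longleftrightarrow>
    (\<exists>I\<in>F. \<exists>J\<in>F. dense_ideal S I \<and> dense_ideal S J \<and> bijective_morphism S I J \<alpha>)"
proof -
  have "essential M (semigroup_inv M \<alpha> \<otimes>\<^bsub>M\<^esub> \<alpha>) \<and> essential M (\<alpha> \<otimes>\<^bsub>M\<^esub> semigroup_inv M \<alpha>) \<longleftrightarrow>
      dense_ideal S I \<and> dense_ideal S J"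
    if "I \<in> F" "J \<in> F" "bijective_morphism S I J \<alpha>" for I J
    using semigroup_inv_M[OF that] essential_id_iff that by (simp add: mult_M)
  then show ?thesis unfolding essential_part_def by (auto simp: carrier_M)
qed

lemma mult_Me: "mult Me = (\<circ>\<^sub>m)"
  by (simp add: essential_part_def mult_M)

lemma Me_defined_on_tail:
  assumes "\<alpha> \<in> carrier Me"
  obtains n where "tail n \<subseteq> dom \<alpha>"
proof -
  obtain I J where "I \<in> F" "dense_ideal S I" "bijective_morphism S I J \<alpha>"
    using assms unfolding carrier_Me by blast
  then show ?thesis using dense_contains_tail[of I] bijective_morphism_dom that by blast
qed

lemma restrict_mem_Me:
  assumes "bijective_morphism S I J \<alpha>" "right_ideal S I" "right_ideal S J" "dense_ideal S J"
    and "K \<in> F" "dense_ideal S K" "K \<subseteq> I"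
  shows "\<alpha> |` K \<in> carrier Me"
  unfolding carrier_Me
  using bijective_morphism_restrict[OF assms(1) right_ideal[OF assms(5)] assms(7)]
    dense_ideal_image[OF assms(1,2,4,6,7)] image_mem[OF assms(1,3,5,7)] assms(5,6) by blast

text \<open>
  Let \<open>K\<close> be the intersection of the domain of \<open>\<alpha>\<close> with the range of \<open>\<beta>\<close>. The domain of the composite
  is the image of \<open>K\<close> under the converse of \<open>\<beta>\<close>, and its range is the image of \<open>K\<close> under \<open>\<alpha>\<close>.
\<close>

lemma Me_closed:
  assumes "\<alpha> \<in> carrier Me" "\<beta> \<in> carrier Me"
  shows "\<alpha> \<circ>\<^sub>m \<beta> \<in> carrier Me"
proof -
  obtain I J where \<alpha>: "I \<in> F" "J \<in> F" "dense_ideal S I" "dense_ideal S J"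
    "bijective_morphism S I J \<alpha>" using assms(1) unfolding carrier_Me by blast
  obtain I' J' where \<beta>: "I' \<in> F" "J' \<in> F" "dense_ideal S I'" "dense_ideal S J'"
    "bijective_morphism S I' J' \<beta>" using assms(2) unfolding carrier_Me by blast
  obtain \<gamma> where \<gamma>: "bijective_morphism S J' I' \<gamma>" "\<And>x y. \<gamma> y = Some x \<longleftrightarrow> \<beta> x = Some y"
    using bijective_morphism_converse[OF \<beta>(5)] by blast
  let ?K = "I \<inter> J'"
  have K: "?K \<in> F" "dense_ideal S ?K"
    using Int_mem \<alpha> \<beta> dense_ideal_Int right_ideal by auto
  have "dom (\<alpha> \<circ>\<^sub>m \<beta>) = (the \<circ> \<gamma>) ` ?K"
  proof (intro subset_antisym subsetI)
    fix x assume "x \<in> dom (\<alpha> \<circ>\<^sub>m \<beta>)"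
    then obtain y z where y: "\<beta> x = Some y" "\<alpha> y = Some z" by (auto simp: map_comp_Some_iff)
    then have "\<gamma> y = Some x" "y \<in> ?K"
      using \<gamma>(2) bijective_morphism_dom[OF \<alpha>(5)] bijective_morphism_ran[OF \<beta>(5)]
      by (auto intro: ranI)
    then show "x \<in> (the \<circ> \<gamma>) ` ?K" by (force simp: image_iff)
  next
    fix x assume "x \<in> (the \<circ> \<gamma>) ` ?K"
    then obtain y where y: "y \<in> ?K" "x = the (\<gamma> y)" by auto
    then have "\<gamma> y = Some x" using bijective_morphism_dom[OF \<gamma>(1)] by force
    then show "x \<in> dom (\<alpha> \<circ>\<^sub>m \<beta>)"
      using \<gamma>(2) y bijective_morphism_dom[OF \<alpha>(5)] by (auto simp: map_comp_def)
  qed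
  then have dom: "dom (\<alpha> \<circ>\<^sub>m \<beta>) \<in> F" "dense_ideal S (dom (\<alpha> \<circ>\<^sub>m \<beta>))"
    using image_mem[OF \<gamma>(1)] dense_ideal_image[OF \<gamma>(1)] K right_ideal \<beta> by auto
  have "ran (\<alpha> \<circ>\<^sub>m \<beta>) = (the \<circ> \<alpha>) ` ?K"
  proof (intro subset_antisym subsetI)
    fix z assume "z \<in> ran (\<alpha> \<circ>\<^sub>m \<beta>)"
    then obtain x y where "\<beta> x = Some y" "\<alpha> y = Some z" by (auto simp: ran_def map_comp_Some_iff)
    moreover from this have "y \<in> ?K"
      using bijective_morphism_dom[OF \<alpha>(5)] bijective_morphism_ran[OF \<beta>(5)] by (auto intro: ranI)
    ultimately show "z \<in> (the \<circ> \<alpha>) ` ?K" by (force simp: image_iff)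
  next
    fix z assume "z \<in> (the \<circ> \<alpha>) ` ?K"
    then obtain y where y: "y \<in> ?K" "z = the (\<alpha> y)" by auto
    then have "\<alpha> y = Some z" using bijective_morphism_dom[OF \<alpha>(5)] by force
    moreover obtain x where "\<beta> x = Some y" using y bijective_morphism_ran[OF \<beta>(5)]
      by (auto simp: ran_def)
    ultimately have "(\<alpha> \<circ>\<^sub>m \<beta>) x = Some z" by simp
    then show "z \<in> ran (\<alpha> \<circ>\<^sub>m \<beta>)" by (rule ranI)
  qed
  then have "ran (\<alpha> \<circ>\<^sub>m \<beta>) \<in> F" "dense_ideal S (ran (\<alpha> \<circ>\<^sub>m \<beta>))"
    using image_mem[OF \<alpha>(5)] dense_ideal_image[OF \<alpha>(5)] K right_ideal \<alpha> by auto
  then show ?thesis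
    unfolding carrier_Me using dom bijective_morphism_comp[OF \<alpha>(5) \<beta>(5)] by blast
qed

lemma natural_le_Me:
  assumes "u \<in> carrier Me" "\<alpha> \<in> carrier Me"
  shows "natural_le Me u \<alpha> \<longleftrightarrow> u \<subseteq>\<^sub>m \<alpha>"
proof
  assume "natural_le Me u \<alpha>"
  then obtain e where e: "e \<in> carrier Me" "e \<circ>\<^sub>m e = e" "u = \<alpha> \<circ>\<^sub>m e"
    unfolding natural_le_def idempotents_def mult_Me by blast
  then obtain I where "e = Some |` I" unfolding carrier_Me using idempotent_eq_id by blast
  then show "u \<subseteq>\<^sub>m \<alpha>"
    using e(3) by (simp add: map_le_def map_comp_restrict_right)
next
  assume le: "u \<subseteq>\<^sub>m \<alpha>"
  obtain I where I: "I \<in> F" "dense_ideal S I" "dom u = I"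
    using assms(1) bijective_morphism_dom unfolding carrier_Me by blast
  have "Some |` I \<in> carrier Me"
    unfolding carrier_Me using I bijective_morphism_id right_ideal by blast
  then have "Some |` I \<in> idempotents Me"
    by (auto simp: idempotents_def mult_Me map_comp_restrict_id)
  moreover have "u = \<alpha> \<circ>\<^sub>m (Some |` I)"
  proof
    fix x show "u x = (\<alpha> \<circ>\<^sub>m (Some |` I)) x"
      using le I(3) by (cases "x \<in> dom u") (auto simp: map_le_def map_comp_restrict_right)
  qed
  ultimately show "natural_le Me u \<alpha>" unfolding natural_le_def mult_Me by blast
qed

end

context k_monoid
begin

text \<open>
  This relation does not refer to a family of ideals; therefore the congruences of two families
  can be compared through it.
\<close>

definition agree_on_tail :: "('a \<rightharpoonup> 'a) \<Rightarrow> ('a \<rightharpoonup> 'a) \<Rightarrow> bool" where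
  "agree_on_tail \<alpha> \<beta> \<longleftrightarrow> (\<exists>n. \<forall>x\<in>tail n. \<alpha> x \<noteq> None \<and> \<alpha> x = \<beta> x)"

end

context ideal_family
begin

text \<open>
  A common lower bound is defined on a dense ideal of \<open>F\<close>, which contains a tail; conversely, the
  common restriction to a tail belongs to the essential part.
\<close>

lemma min_group_cong_Me:
  "min_group_cong Me = {(\<alpha>, \<beta>). \<alpha> \<in> carrier Me \<and> \<beta> \<in> carrier Me \<and> agree_on_tail \<alpha> \<beta>}"
proof -
  have "(\<exists>u\<in>carrier Me. natural_le Me u \<alpha> \<and> natural_le Me u \<beta>) \<longleftrightarrow> agree_on_tail \<alpha> \<beta>"
    if mem: "\<alpha> \<in> carrier Me" "\<beta> \<in> carrier Me" for \<alpha> \<beta>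
  proof
    assume "\<exists>u\<in>carrier Me. natural_le Me u \<alpha> \<and> natural_le Me u \<beta>"
    then obtain u where u: "u \<in> carrier Me" "u \<subseteq>\<^sub>m \<alpha>" "u \<subseteq>\<^sub>m \<beta>" using natural_le_Me mem by blast
    then obtain n where "tail n \<subseteq> dom u"
      using Me_defined_on_tail by blast
    then show "agree_on_tail \<alpha> \<beta>"
      using u(2,3) unfolding agree_on_tail_def map_le_def by (metis domIff subsetD)
  next
    assume "agree_on_tail \<alpha> \<beta>"
    then obtain n where n: "\<And>x. x \<in> tail n \<Longrightarrow> \<alpha> x \<noteq> None \<and> \<alpha> x = \<beta> x"
      unfolding agree_on_tail_def by blast
    obtain I J where \<alpha>: "I \<in> F" "J \<in> F" "dense_ideal S J" "bijective_morphism S I J \<alpha>"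
      using mem(1) unfolding carrier_Me by blast
    have "tail n \<subseteq> I" using n bijective_morphism_dom[OF \<alpha>(4)] by blast
    then have "\<alpha> |` tail n \<in> carrier Me"
      using restrict_mem_Me[OF \<alpha>(4)] right_ideal \<alpha> tail_mem dense_ideal_tail by blast
    moreover have "\<alpha> |` tail n \<subseteq>\<^sub>m \<alpha>" "\<alpha> |` tail n \<subseteq>\<^sub>m \<beta>" using n by (auto simp: map_le_def)
    ultimately show "\<exists>u\<in>carrier Me. natural_le Me u \<alpha> \<and> natural_le Me u \<beta>"
      using natural_le_Me mem by blast
  qed
  then show ?thesis unfolding min_group_cong_def by blast
qed

lemma equiv_min_group_cong_Me: "equiv (carrier Me) (min_group_cong Me)"
proof (rule equivI)
  show "min_group_cong Me \<subseteq> carrier Me \<times> carrier Me" by (auto simp: min_group_cong_Me)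
  have "agree_on_tail \<alpha> \<alpha>" if \<alpha>: "\<alpha> \<in> carrier Me" for \<alpha>
  proof -
    obtain n where "tail n \<subseteq> dom \<alpha>" using Me_defined_on_tail[OF \<alpha>] by blast
    then show ?thesis unfolding agree_on_tail_def by blast
  qed
  then show "refl_on (carrier Me) (min_group_cong Me)"
    by (auto simp: refl_on_def min_group_cong_Me)
  show "sym (min_group_cong Me)"
    unfolding sym_def min_group_cong_Me agree_on_tail_def by auto metis
  have "agree_on_tail \<alpha> \<gamma>" if \<alpha>\<beta>: "agree_on_tail \<alpha> \<beta>" and \<beta>\<gamma>: "agree_on_tail \<beta> \<gamma>" for \<alpha> \<beta> \<gamma>
  proof -
    obtain m n where "\<And>x. x \<in> tail m \<Longrightarrow> \<alpha> x \<noteq> None \<and> \<alpha> x = \<beta> x"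
      "\<And>x. x \<in> tail n \<Longrightarrow> \<beta> x \<noteq> None \<and> \<beta> x = \<gamma> x"
      using \<alpha>\<beta> \<beta>\<gamma> unfolding agree_on_tail_def by blast
    then have "\<forall>x\<in>tail (m + n). \<alpha> x \<noteq> None \<and> \<alpha> x = \<gamma> x"
      using tail_add_subset[of m n] by (metis subsetD)
    then show ?thesis unfolding agree_on_tail_def by blast
  qed
  then show "trans (min_group_cong Me)"
    unfolding trans_def min_group_cong_Me by blast
qed

text \<open>
  A morphism can lower the degree only by a bounded amount on a tail: an element \<open>cs\<close> with \<open>d c = m\<close> and
  \<open>c\<close> in the domain is mapped to \<open>\<beta>(c)s\<close>, whose degree is at least \<open>d s\<close>. So \<open>\<beta>\<close> maps \<open>tail (m + n)\<close> into
  \<open>tail n\<close>.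
\<close>

lemma agree_on_tail_comp:
  assumes mem: "\<beta> \<in> carrier Me"
    and \<alpha>: "agree_on_tail \<alpha> \<alpha>'" and \<beta>: "agree_on_tail \<beta> \<beta>'"
  shows "agree_on_tail (\<alpha> \<circ>\<^sub>m \<beta>) (\<alpha>' \<circ>\<^sub>m \<beta>')"
proof -
  obtain n where n: "\<And>x. x \<in> tail n \<Longrightarrow> \<alpha> x \<noteq> None \<and> \<alpha> x = \<alpha>' x"
    using \<alpha> unfolding agree_on_tail_def by blast
  obtain m where m: "\<And>x. x \<in> tail m \<Longrightarrow> \<beta> x \<noteq> None \<and> \<beta> x = \<beta>' x"
    using \<beta> unfolding agree_on_tail_def by blast
  obtain I J where IJ: "right_ideal S J" "bijective_morphism S I J \<beta>"
    using mem right_ideal unfolding carrier_Me by blast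
  have "(\<alpha> \<circ>\<^sub>m \<beta>) x \<noteq> None \<and> (\<alpha> \<circ>\<^sub>m \<beta>) x = (\<alpha>' \<circ>\<^sub>m \<beta>') x" if "x \<in> tail (m + n)" for x
  proof -
    obtain r where "x \<in> carrier S" "d x = m + (n + r)"
      using \<open>x \<in> tail (m + n)\<close> by (auto simp: tail_def add.assoc)
    then obtain c s where cs: "c \<in> carrier S" "s \<in> carrier S" "x = c \<otimes> s" "d c = m" "d s = n + r"
      using factorization_exists by metis
    have "c \<in> tail m" using cs unfolding tail_def by (auto intro: exI[of _ 0])
    then obtain y where y: "\<beta> c = Some y" using m by blast
    have yc: "y \<in> carrier S"
      using y IJ bijective_morphism_ran[OF IJ(2)] unfolding right_ideal_def by (auto intro: ranI)
    have \<beta>x: "\<beta> x = Some (y \<otimes> s)" unfolding cs(3) by (rule bijective_morphism_mult[OF IJ(2) y cs(2)])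
    have "d (y \<otimes> s) = n + (d y + r)" using yc cs degree_mult by (simp add: add.left_commute)
    then have "y \<otimes> s \<in> tail n" using yc cs unfolding tail_def by auto
    moreover have "\<beta>' x = Some (y \<otimes> s)"
      using m[of x] that tail_add_subset(1)[of m n] \<beta>x by auto
    moreover obtain z where "\<alpha> (y \<otimes> s) = Some z" "\<alpha>' (y \<otimes> s) = Some z"
      using n[OF \<open>y \<otimes> s \<in> tail n\<close>] by (metis not_None_eq)
    ultimately show ?thesis using \<beta>x by (simp add: map_comp_def)
  qed
  then show ?thesis unfolding agree_on_tail_def by blast
qed

end


section \<open>Comparing the maximal group images\<close>

lemma min_group_cong_class_mult:
  assumes closed: "\<And>x y. x \<in> carrier T \<Longrightarrow> y \<in> carrier T \<Longrightarrow> x \<otimes>\<^bsub>T\<^esub> y \<in> carrier T"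
    and equiv: "equiv (carrier T) (min_group_cong T)"
    and cong: "\<And>x x' y y'. (x, x') \<in> min_group_cong T \<Longrightarrow> (y, y') \<in> min_group_cong T \<Longrightarrow>
      (x \<otimes>\<^bsub>T\<^esub> y, x' \<otimes>\<^bsub>T\<^esub> y') \<in> min_group_cong T"
    and "x \<in> carrier T" "y \<in> carrier T"
  shows "min_group_cong T `` (min_group_cong T `` {x} <#>\<^bsub>T\<^esub> min_group_cong T `` {y}) =
    min_group_cong T `` {x \<otimes>\<^bsub>T\<^esub> y}" (is "?s `` ?P = _")
proof
  have sub: "?P \<subseteq> ?s `` {x \<otimes>\<^bsub>T\<^esub> y}" using cong by (auto simp: set_mult_def)
  have "trans ?s" using equiv by (simp add: equiv_def)
  then show "?s `` ?P \<subseteq> ?s `` {x \<otimes>\<^bsub>T\<^esub> y}" using sub by (blast dest: transD)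
  have "(x, x) \<in> ?s" "(y, y) \<in> ?s"
    using equiv assms(4,5) by (auto simp: equiv_def refl_on_def)
  then have "x \<otimes>\<^bsub>T\<^esub> y \<in> ?P" by (auto simp: set_mult_def)
  then show "?s `` {x \<otimes>\<^bsub>T\<^esub> y} \<subseteq> ?s `` ?P" by blast
qed

text \<open>
  The map sends a class of \<open>T\<close> to the class of \<open>U\<close> that contains it, which is its image under the larger
  congruence. It is injective because the smaller congruence is the restriction of the larger one, and
  surjective because every class of \<open>U\<close> meets \<open>T\<close>.
\<close>

lemma min_group_quotient_iso_subsemigroup:
  fixes T U :: "('c, 'd) monoid_scheme"
  assumes sub: "carrier T \<subseteq> carrier U" and mult: "mult T = mult U"
    and closed_T: "\<And>x y. x \<in> carrier T \<Longrightarrow> y \<in> carrier T \<Longrightarrow> x \<otimes>\<^bsub>T\<^esub> y \<in> carrier T"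
    and closed_U: "\<And>x y. x \<in> carrier U \<Longrightarrow> y \<in> carrier U \<Longrightarrow> x \<otimes>\<^bsub>U\<^esub> y \<in> carrier U"
    and equiv: "equiv (carrier U) (min_group_cong U)"
    and cong: "\<And>x x' y y'. (x, x') \<in> min_group_cong U \<Longrightarrow> (y, y') \<in> min_group_cong U \<Longrightarrow>
      (x \<otimes>\<^bsub>U\<^esub> y, x' \<otimes>\<^bsub>U\<^esub> y') \<in> min_group_cong U"
    and restrict: "min_group_cong T = min_group_cong U \<inter> carrier T \<times> carrier T"
    and meets: "\<And>u. u \<in> carrier U \<Longrightarrow> \<exists>t\<in>carrier T. (u, t) \<in> min_group_cong U"
  shows "min_group_quotient T \<cong> min_group_quotient U"
proof -
  let ?s = "min_group_cong T" and ?r = "min_group_cong U"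
  let ?h = "\<lambda>A. ?r `` A"
  have rfl: "(x, x) \<in> ?r" if "x \<in> carrier U" for x
    using equiv that by (auto simp: equiv_def refl_on_def)
  have sym: "(y, x) \<in> ?r" if "(x, y) \<in> ?r" for x y
    using equiv that by (auto simp: equiv_def dest: symD)
  have trans: "(x, z) \<in> ?r" if "(x, y) \<in> ?r" "(y, z) \<in> ?r" for x y z
    using equiv that by (auto simp: equiv_def dest: transD)
  have equiv_T: "equiv (carrier T) ?s"
  proof (rule equivI)
    show "refl_on (carrier T) ?s" using rfl sub by (auto simp: refl_on_def restrict)
    show "sym ?s" using sym by (auto simp: sym_def restrict)
    show "trans ?s" using trans by (auto simp: trans_def restrict)
  qed (simp add: restrict)
  have cong_T: "(x \<otimes>\<^bsub>T\<^esub> y, x' \<otimes>\<^bsub>T\<^esub> y') \<in> ?s" if "(x, x') \<in> ?s" "(y, y') \<in> ?s" for x x' y y'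
    using that closed_T cong[of x x' y y'] unfolding restrict by (auto simp: mult)
  have h: "?h (?s `` {x}) = ?r `` {x}" if "x \<in> carrier T" for x
  proof
    show "?h (?s `` {x}) \<subseteq> ?r `` {x}" using trans by (auto simp: restrict)
    have "x \<in> ?s `` {x}" using that rfl sub by (auto simp: restrict)
    then show "?r `` {x} \<subseteq> ?h (?s `` {x})" by blast
  qed
  have "?h \<in> hom (min_group_quotient T) (min_group_quotient U)"
  proof (rule homI)
    fix A assume "A \<in> carrier (min_group_quotient T)"
    then obtain x where "x \<in> carrier T" "A = ?s `` {x}"
      by (auto simp: min_group_quotient_def elim: quotientE)
    then show "?h A \<in> carrier (min_group_quotient U)"
      using h sub by (auto simp: min_group_quotient_def intro!: quotientI)
  next
    fix A B assume "A \<in> carrier (min_group_quotient T)" "B \<in> carrier (min_group_quotient T)"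
    then obtain x y where xy: "x \<in> carrier T" "A = ?s `` {x}" "y \<in> carrier T" "B = ?s `` {y}"
      by (auto simp: min_group_quotient_def elim!: quotientE)
    have "?h (?s `` (A <#>\<^bsub>T\<^esub> B)) = ?h (?s `` {x \<otimes>\<^bsub>T\<^esub> y})"
      using min_group_cong_class_mult[OF closed_T equiv_T cong_T xy(1,3)] xy by simp
    also have "\<dots> = ?r `` {x \<otimes>\<^bsub>U\<^esub> y}" using h closed_T xy by (simp add: mult)
    also have "\<dots> = ?r `` (?r `` {x} <#>\<^bsub>U\<^esub> ?r `` {y})"
      using min_group_cong_class_mult[OF closed_U equiv cong] xy sub by (simp add: subset_iff)
    also have "\<dots> = ?r `` (?h A <#>\<^bsub>U\<^esub> ?h B)" using h xy by simp
    finally show "?h (A \<otimes>\<^bsub>min_group_quotient T\<^esub> B) = ?h A \<otimes>\<^bsub>min_group_quotient U\<^esub> ?h B"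
      by (simp add: min_group_quotient_def)
  qed
  moreover have "inj_on ?h (carrier T // ?s)"
  proof (rule inj_onI)
    fix A B assume "A \<in> carrier T // ?s" "B \<in> carrier T // ?s" and eq: "?h A = ?h B"
    then obtain x y where xy: "x \<in> carrier T" "A = ?s `` {x}" "y \<in> carrier T" "B = ?s `` {y}"
      by (auto elim!: quotientE)
    then have "?r `` {x} = ?r `` {y}" using eq h by simp
    then have "(x, y) \<in> ?s" using xy rfl sub unfolding restrict by blast
    then show "A = B" using xy equiv_class_eq[OF equiv_T] by simp
  qed
  moreover have "?h ` (carrier T // ?s) = carrier U // ?r"
  proof
    show "?h ` (carrier T // ?s) \<subseteq> carrier U // ?r"
      using h sub by (auto elim!: quotientE intro!: quotientI)
    show "carrier U // ?r \<subseteq> ?h ` (carrier T // ?s)"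
    proof
      fix B assume "B \<in> carrier U // ?r"
      then obtain u where u: "u \<in> carrier U" "B = ?r `` {u}" by (auto elim: quotientE)
      then obtain t where t: "t \<in> carrier T" "(u, t) \<in> ?r" using meets by blast
      then have "B = ?h (?s `` {t})" using u h equiv_class_eq[OF equiv t(2)] by simp
      then show "B \<in> ?h ` (carrier T // ?s)" using t by (blast intro: quotientI)
    qed
  qed
  ultimately have "?h \<in> iso (min_group_quotient T) (min_group_quotient U)"
    unfolding iso_def bij_betw_def by (simp add: min_group_quotient_def)
  then show ?thesis unfolding is_iso_def by blast
qed

lemma min_group_quotient_iso_ideal_families:
  assumes "ideal_family S d F" "ideal_family S d G" "F \<subseteq> G"
  shows "min_group_quotient (essential_part (morphism_monoid S F))
    \<cong> min_group_quotient (essential_part (morphism_monoid S G))"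
proof -
  interpret F: ideal_family S d F by fact
  interpret G: ideal_family S d G by fact
  show ?thesis
  proof (rule min_group_quotient_iso_subsemigroup)
    show sub: "carrier F.Me \<subseteq> carrier G.Me"
      using \<open>F \<subseteq> G\<close> unfolding subset_iff F.carrier_Me G.carrier_Me by blast
    show "mult F.Me = mult G.Me" unfolding F.mult_Me G.mult_Me ..
    show "x \<otimes>\<^bsub>F.Me\<^esub> y \<in> carrier F.Me" if "x \<in> carrier F.Me" "y \<in> carrier F.Me" for x y
      using F.Me_closed that by (simp add: F.mult_Me)
    show closed: "x \<otimes>\<^bsub>G.Me\<^esub> y \<in> carrier G.Me" if "x \<in> carrier G.Me" "y \<in> carrier G.Me" for x y
      using G.Me_closed that by (simp add: G.mult_Me)
    show "equiv (carrier G.Me) (min_group_cong G.Me)" by (rule G.equiv_min_group_cong_Me)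
    show "(x \<otimes>\<^bsub>G.Me\<^esub> y, x' \<otimes>\<^bsub>G.Me\<^esub> y') \<in> min_group_cong G.Me"
      if "(x, x') \<in> min_group_cong G.Me" "(y, y') \<in> min_group_cong G.Me" for x x' y y'
      using that closed G.agree_on_tail_comp unfolding G.min_group_cong_Me by (simp add: G.mult_Me)
    show "min_group_cong F.Me = min_group_cong G.Me \<inter> carrier F.Me \<times> carrier F.Me"
      using sub unfolding F.min_group_cong_Me G.min_group_cong_Me by auto
    show "\<exists>\<beta>\<in>carrier F.Me. (\<alpha>, \<beta>) \<in> min_group_cong G.Me" if \<alpha>: "\<alpha> \<in> carrier G.Me" for \<alpha>
    proof -
      obtain I J where IJ: "I \<in> G" "J \<in> G" "dense_ideal S I" "dense_ideal S J"
        "bijective_morphism S I J \<alpha>" using \<alpha> unfolding G.carrier_Me by blast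
      obtain n where n: "F.tail n \<subseteq> I" using G.dense_contains_tail IJ by blast
      have mem: "\<alpha> |` F.tail n \<in> carrier F.Me"
        using F.restrict_mem_Me[OF IJ(5)] G.right_ideal IJ n F.tail_mem F.dense_ideal_tail by blast
      have "F.agree_on_tail \<alpha> (\<alpha> |` F.tail n)"
        unfolding F.agree_on_tail_def using n bijective_morphism_dom[OF IJ(5)]
        by (intro exI[of _ n]) auto
      then show ?thesis using mem sub \<alpha> unfolding G.min_group_cong_Me by blast
    qed
  qed
qed

section \<open>The finitely generated and the projective right ideals\<close>

context finite_k_monoid
begin

lemma ideal_family_fg: "ideal_family S d {I. fg_right_ideal S I}"
proof
  fix I assume "I \<in> {I. fg_right_ideal S I}"
  then show "right_ideal S I" using right_ideal_generated unfolding fg_right_ideal_def by blast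
next
  show "{} \<in> {I. fg_right_ideal S I}"
    unfolding fg_right_ideal_def by (auto simp: set_mult_def intro!: exI[of _ "{}"])
next
  fix a assume "a \<in> carrier S"
  then show "{a} <#> carrier S \<in> {I. fg_right_ideal S I}"
    unfolding fg_right_ideal_def by (auto intro!: exI[of _ "{a}"])
next
  fix I J assume "I \<in> {I. fg_right_ideal S I}" "J \<in> {I. fg_right_ideal S I}"
  then obtain X Y where XY: "finite X" "X \<subseteq> carrier S" "I = X <#> carrier S"
    "finite Y" "Y \<subseteq> carrier S" "J = Y <#> carrier S"
    unfolding fg_right_ideal_def by blast
  have "I \<inter> J = common_multiples X Y <#> carrier S"
    unfolding XY(3,6) by (rule Int_generated[OF XY(2,5)])
  then show "I \<inter> J \<in> {I. fg_right_ideal S I}"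
    unfolding fg_right_ideal_def
    using finite_common_multiples[OF XY(1,4)] common_multiples_carrier by blast
next
  fix I J K \<alpha>
  assume \<alpha>: "bijective_morphism S I J \<alpha>" and J: "right_ideal S J"
    and K: "K \<in> {I. fg_right_ideal S I}" "K \<subseteq> I"
  then obtain X where X: "finite X" "X \<subseteq> carrier S" "K = X <#> carrier S"
    unfolding fg_right_ideal_def by blast
  show "(the \<circ> \<alpha>) ` K \<in> {I. fg_right_ideal S I}"
    using image_generators[OF \<alpha> J X(2)] X K(2) unfolding fg_right_ideal_def by blast
next
  fix n
  show "tail n \<in> {I. fg_right_ideal S I}"
    unfolding fg_right_ideal_def tail_eq_generated using level_finite_nonempty[of n]
    by (auto simp: level_def)
next
  fix I assume "I \<in> {I. fg_right_ideal S I}" "dense_ideal S I"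
  then show "\<exists>n. tail n \<subseteq> I"
    using dense_generated_contains_tail unfolding fg_right_ideal_def by blast
qed

lemma ideal_family_projective: "ideal_family S d (insert {} {I. projective_right_ideal S I})"
proof
  fix I assume "I \<in> insert {} {I. projective_right_ideal S I}"
  then show "right_ideal S I"
    using right_ideal_generated
    unfolding projective_right_ideal_def generalized_prefix_code_def right_ideal_def by auto
next
  fix a assume "a \<in> carrier S"
  then show "{a} <#> carrier S \<in> insert {} {I. projective_right_ideal S I}"
    unfolding projective_right_ideal_def generalized_prefix_code_def
    by (auto intro!: exI[of _ "{a}"])
next
  fix I J assume IJ: "I \<in> insert {} {I. projective_right_ideal S I}"
    "J \<in> insert {} {I. projective_right_ideal S I}"
  show "I \<inter> J \<in> insert {} {I. projective_right_ideal S I}"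
  proof (cases "I \<inter> J = {}")
    case False
    then obtain X Y where XY: "generalized_prefix_code S X" "I = X <#> carrier S"
      "generalized_prefix_code S Y" "J = Y <#> carrier S"
      using IJ unfolding projective_right_ideal_def by blast
    then have fin: "finite X" "finite Y" "X \<subseteq> carrier S" "Y \<subseteq> carrier S"
      unfolding generalized_prefix_code_def by auto
    have eq: "I \<inter> J = common_multiples X Y <#> carrier S" using Int_generated fin XY by simp
    then have "common_multiples X Y \<noteq> {}" using False by (auto simp: set_mult_def)
    then have "generalized_prefix_code S (common_multiples X Y)"
      using common_multiples_incomparable[OF XY(1,3)] finite_common_multiples[OF fin(1,2)]
        common_multiples_carrier[of X Y]
      unfolding generalized_prefix_code_def by metis
    then show ?thesis using eq unfolding projective_right_ideal_def by blast
  qed simp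
next
  fix I J K \<alpha>
  assume \<alpha>: "bijective_morphism S I J \<alpha>" and J: "right_ideal S J"
    and K: "K \<in> insert {} {I. projective_right_ideal S I}" "K \<subseteq> I"
  show "(the \<circ> \<alpha>) ` K \<in> insert {} {I. projective_right_ideal S I}"
  proof (cases "K = {}")
    case False
    then obtain X where X: "generalized_prefix_code S X" "K = X <#> carrier S"
      using K unfolding projective_right_ideal_def by blast
    then have "X \<subseteq> carrier S" unfolding generalized_prefix_code_def by blast
    then show ?thesis
      using image_generators(3)[OF \<alpha> J] generalized_prefix_code_image[OF \<alpha> J X(1)] X K(2)
      unfolding projective_right_ideal_def by blast
  qed simp
next
  fix n
  show "tail n \<in> insert {} {I. projective_right_ideal S I}"
    unfolding projective_right_ideal_def tail_eq_generated using level_prefix_code by blast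
next
  fix I assume I: "I \<in> insert {} {I. projective_right_ideal S I}" "dense_ideal S I"
  then have "I \<noteq> {}" using one_closed unfolding dense_ideal_def by blast
  then show "\<exists>n. tail n \<subseteq> I"
    using I dense_generated_contains_tail
    unfolding projective_right_ideal_def generalized_prefix_code_def by blast
qed simp

end

lemma R_monoid_eq: "R_monoid S = morphism_monoid S {I. fg_right_ideal S I}"
  unfolding R_monoid_def morphism_monoid_def by auto

text \<open>
  The empty function, which is adjoined separately in \<open>P_monoid\<close>, is the only bijective morphism with
  empty domain or empty range; this amounts to adjoining the empty ideal to the projective ones.
\<close>

lemma P_monoid_eq: "P_monoid S = morphism_monoid S (insert {} {I. projective_right_ideal S I})"
proof -
  have "\<alpha> = Map.empty" if "bijective_morphism S I J \<alpha>" "I = {} \<or> J = {}" for I J \<alpha>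
    using that unfolding bijective_morphism_def dom_def ran_def by fastforce
  moreover have "bijective_morphism S {} {} Map.empty"
    by (simp add: bijective_morphism_def)
  ultimately have "insert Map.empty {\<alpha>. \<exists>I J. projective_right_ideal S I \<and>
      projective_right_ideal S J \<and> bijective_morphism S I J \<alpha>} =
    {\<alpha>. \<exists>I\<in>insert {} {I. projective_right_ideal S I}.
      \<exists>J\<in>insert {} {I. projective_right_ideal S I}. bijective_morphism S I J \<alpha>}"
    by blast
  then show ?thesis unfolding P_monoid_def R_monoid_def morphism_monoid_def by simp
qed

theorem theorem7p11:
  fixes S :: "('a, 'b) monoid_scheme"
    and d :: "'a \<Rightarrow> nat ^ 'k"
  assumes "k_monoid S d"
    and "finitely_aligned S"
    and "\<And>i. finite (alphabet S d i) \<and> card (alphabet S d i) \<ge> 2"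
  shows "min_group_quotient (essential_part (P_monoid S))
    \<cong> min_group_quotient (essential_part (R_monoid S))"
proof -
  interpret k_monoid S d by fact
  have nonempty: "alphabet S d i \<noteq> {}" for i using assms(3)[of i] by auto
  interpret finite_k_monoid S d by unfold_locales (use assms(3) nonempty in auto)
  have "{} <#>\<^bsub>S\<^esub> carrier S = {}" by (simp add: set_mult_def)
  then have "insert {} {I. projective_right_ideal S I} \<subseteq> {I. fg_right_ideal S I}"
    unfolding projective_right_ideal_def generalized_prefix_code_def fg_right_ideal_def
    by (auto intro: exI[of _ "{}"])
  then show ?thesis
    unfolding P_monoid_eq R_monoid_eq
    using min_group_quotient_iso_ideal_families[OF ideal_family_projective ideal_family_fg] by blast
qed

end
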